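(* Let $G$ be a graph on which median dynamics is well defined, and let $(\eta_t)_{t\ge 0}$ denote median dynamics on $G$. Fix $p\in[0,1]$ and define $$\xi^p_t(x)=\mathbf 1_{[0,p]}(\eta_t(x)),\qquad x\in V(G),\ t\ge 0.$$ Then the process $(\xi^p_t)_{t\ge0}$ performs majority dynamics on $G$ with initial condition distributed as i.i.d. $\mathrm{Bernoulli}(p)$.
   Context: $G=(V(G),E(G))$ is a locally finite (possibly infinite) simple undirected graph with countable vertex set, and $x\sim y$ denotes adjacency. $N(x)=\{y: y\sim x\}$ and $\deg(x)$ is the number of neighbors of $x$. Convention: if $\deg(x)$ is even, $x$ itself is added to $N(x)$, so that $|N(x)|$ is always odd. Median dynamics $(\eta_t)_{t\ge0}$ has state space $[0,1]^{V(G)}$. The initial values $(\eta_0(x))_{x\in V(G)}$ are i.i.d. uniform on $[0,1]$. Independently, each vertex has an independent rate-one Poisson clock. At each ring $s$ of the clock of $x$, the value at $x$ is replaced by the median of $\{\eta_{s-}(z): z\in N(x)\}$ (counted with multiplicity), and no other value changes. Median dynamics is well defined on $G$ if, for every $x\in V(G)$ and $t\ge 0$, almost surely $\eta_t(x)$ can be determined from finitely many of the initial values (together with the clocks). More precisely, almost surely there are finitely many vertices $y$ for which there exist a path $x=x_1\sim x_2\sim\dots\sim x_n=y$ and times $t\ge s_1>s_2>\dots>s_{n-1}>0$ such that the clock of $x_i$ rings at time $s_i$ for each $i\le n-1$. This holds in particular for finite graphs and bounded-degree graphs. Majority dynamics has state space $\{0,1\}^{V(G)}$. Each vertex has an independent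 rate-one Poisson clock, independent of the initial condition, and at each ring of the clock of $x$ the value at $x$ is replaced by the most common value among the vertices of $N(x)$ (with the same convention for $N(x)$), other values being unchanged. *)

theory Defs
  imports "HOL-Probability.Probability"
begin

section \<open>Graphs\<close>

definition simple_graph :: "'v set \<Rightarrow> 'v set set \<Rightarrow> bool" where
  "simple_graph V E \<longleftrightarrow> (\<forall>e\<in>E. e \<subseteq> V \<and> card e = 2)"

definition neighbours :: "'v set set \<Rightarrow> 'v \<Rightarrow> 'v set" where
  "neighbours E x = {y. {x, y} \<in> E}"

definition locally_finite_graph :: "'v set \<Rightarrow> 'v set set \<Rightarrow> bool" where
  "locally_finite_graph V E \<longleftrightarrow> (\<forall>x\<in>V. finite (neighbours E x))"

definition odd_nbhd :: "'v set set \<Rightarrow> 'v \<Rightarrow> 'v set" where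
  "odd_nbhd E x =
    (if even (card (neighbours E x)) then insert x (neighbours E x) else neighbours E x)"

section \<open>Median and most common value\<close>

text \<open>Both functions are only meant for multisets of odd size, where the median is the middle
  entry; the most common value is moreover unique if at most two values occur.\<close>

definition median :: "'b::linorder multiset \<Rightarrow> 'b" where
  "median A = sorted_list_of_multiset A ! (size A div 2)"

definition most_common :: "'b multiset \<Rightarrow> 'b" where
  "most_common A = (THE v. \<forall>w. w \<noteq> v \<longrightarrow> count A w < count A v)"

section \<open>Poisson clocks\<close>

text \<open>A clock is the random set of the times at which it rings.\<close>

definition rings :: "('a \<Rightarrow> real set) \<Rightarrow> real \<Rightarrow> real \<Rightarrow> 'a \<Rightarrow> nat" where
  "rings R s t \<omega> = card (R \<omega> \<inter> {s<..t})"

definition rate_one_poisson_clock :: "'a measure \<Rightarrow> ('a \<Rightarrow> real set) \<Rightarrow> bool" where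
  "rate_one_poisson_clock M R \<longleftrightarrow>
    (AE \<omega> in M. R \<omega> \<subseteq> {0<..} \<and> (\<forall>t. finite (R \<omega> \<inter> {..t}))) \<and>
    (\<forall>\<tau>. incseq \<tau> \<and> \<tau> 0 \<ge> 0 \<longrightarrow>
      prob_space.indep_vars M (\<lambda>_. count_space UNIV)
        (\<lambda>i::nat. rings R (\<tau> i) (\<tau> (Suc i))) UNIV) \<and>
    (\<forall>s t. 0 \<le> s \<and> s < t \<longrightarrow>
      distr M (count_space UNIV) (rings R s t) = measure_pmf (poisson_pmf (t - s)))"

text \<open>The counting process of a clock, and the measurable space of its trajectories.\<close>

abbreviation clock_path :: "('a \<Rightarrow> real set) \<Rightarrow> 'a \<Rightarrow> real \<Rightarrow> nat" where
  "clock_path R \<omega> \<equiv> (\<lambda>t\<in>{0..}. rings R 0 t \<omega>)"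

abbreviation path_space :: "(real \<Rightarrow> nat) measure" where
  "path_space \<equiv> PiM {0..} (\<lambda>_. count_space UNIV)"

definition independent_poisson_clocks ::
    "'v set \<Rightarrow> 'a measure \<Rightarrow> ('v \<Rightarrow> 'a \<Rightarrow> real set) \<Rightarrow> bool" where
  "independent_poisson_clocks V M R \<longleftrightarrow>
    (\<forall>x\<in>V. rate_one_poisson_clock M (R x)) \<and>
    prob_space.indep_vars M (\<lambda>_. path_space) (\<lambda>x. clock_path (R x)) V"

text \<open>The \<sigma>-algebras generated by the initial configuration and by the family of all clocks
  are independent.\<close>

definition initial_independent_of_clocks ::
    "'v set \<Rightarrow> 'a measure \<Rightarrow> ('v \<Rightarrow> 'a \<Rightarrow> real) \<Rightarrow> ('v \<Rightarrow> 'a \<Rightarrow> real set) \<Rightarrow> bool" where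
  "initial_independent_of_clocks V M X0 R \<longleftrightarrow>
    prob_space.indep_set M
      (sets (vimage_algebra (space M) (\<lambda>\<omega>. \<lambda>x\<in>V. X0 x \<omega>) (PiM V (\<lambda>_. borel))))
      (sets (vimage_algebra (space M) (\<lambda>\<omega>. \<lambda>x\<in>V. clock_path (R x) \<omega>)
        (PiM V (\<lambda>_. path_space))))"

definition iid ::
    "'v set \<Rightarrow> 'a measure \<Rightarrow> ('v \<Rightarrow> 'a \<Rightarrow> real) \<Rightarrow> real measure \<Rightarrow> bool" where
  "iid V M X \<mu> \<longleftrightarrow>
    prob_space.indep_vars M (\<lambda>_. borel) X V \<and> (\<forall>x\<in>V. distr M borel (X x) = \<mu>)"

section \<open>Dynamics driven by the clocks\<close>

text \<open>
  A process is a function \<open>X\<close> of time, vertex and sample point; only times \<open>t \<ge> 0\<close> and vertices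
  in \<open>V\<close> matter. The argument \<open>F\<close> is the rule computing the new value at \<open>x\<close> from the multiset
  of the values \<open>X\<^bsub>s-\<^esub>(z)\<close>, \<open>z \<in> N(x)\<close>, where \<open>X\<^bsub>s-\<^esub>(z)\<close> is the limit from the left at
  time \<open>s\<close>. That limit exists because the value at \<open>z\<close> is constant between two consecutive
  rings at \<open>z\<close>.
\<close>

definition updates_at_rings ::
    "(real multiset \<Rightarrow> real) \<Rightarrow> 'v set \<Rightarrow> 'v set set \<Rightarrow> ('v \<Rightarrow> real set) \<Rightarrow>
     (real \<Rightarrow> 'v \<Rightarrow> real) \<Rightarrow> bool" where
  "updates_at_rings F V E r X \<longleftrightarrow>
    (\<forall>x\<in>V.
      (\<forall>s\<in>r x. X s x =
         F (image_mset (\<lambda>z. Lim (at_left s) (\<lambda>u. X u z)) (mset_set (odd_nbhd E x)))) \<and>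
      (\<forall>s t. 0 \<le> s \<and> s \<le> t \<and> r x \<inter> {s<..t} = {} \<longrightarrow> X t x = X s x))"

definition local_dynamics ::
    "(real multiset \<Rightarrow> real) \<Rightarrow> real set \<Rightarrow> 'v set \<Rightarrow> 'v set set \<Rightarrow> 'a measure \<Rightarrow>
     ('v \<Rightarrow> 'a \<Rightarrow> real set) \<Rightarrow> (real \<Rightarrow> 'v \<Rightarrow> 'a \<Rightarrow> real) \<Rightarrow> bool" where
  "local_dynamics F S V E M R X \<longleftrightarrow>
    prob_space M \<and>
    (\<forall>t\<ge>0. \<forall>x\<in>V. X t x \<in> borel_measurable M \<and> (\<forall>\<omega>\<in>space M. X t x \<omega> \<in> S)) \<and>
    independent_poisson_clocks V M R \<and>
    initial_independent_of_clocks V M (X 0) R \<and>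
    (AE \<omega> in M. updates_at_rings F V E (\<lambda>x. R x \<omega>) (\<lambda>t x. X t x \<omega>))"

definition median_dynamics ::
    "'v set \<Rightarrow> 'v set set \<Rightarrow> 'a measure \<Rightarrow> ('v \<Rightarrow> 'a \<Rightarrow> real set) \<Rightarrow>
     (real \<Rightarrow> 'v \<Rightarrow> 'a \<Rightarrow> real) \<Rightarrow> bool" where
  "median_dynamics V E M R \<eta> \<longleftrightarrow>
    local_dynamics median {0..1} V E M R \<eta> \<and>
    iid V M (\<eta> 0) (uniform_measure lborel {0..1})"

definition majority_dynamics ::
    "'v set \<Rightarrow> 'v set set \<Rightarrow> 'a measure \<Rightarrow> ('v \<Rightarrow> 'a \<Rightarrow> real set) \<Rightarrow>
     (real \<Rightarrow> 'v \<Rightarrow> 'a \<Rightarrow> real) \<Rightarrow> bool" where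
  "majority_dynamics V E M R \<xi> \<longleftrightarrow> local_dynamics most_common {0, 1} V E M R \<xi>"

section \<open>Well-definedness\<close>

text \<open>\<open>influences E r t x y\<close>: there are a path \<open>x = x\<^sub>1 \<sim> \<dots> \<sim> x\<^sub>n = y\<close> (the list \<open>xs\<close>) and times
  \<open>t \<ge> s\<^sub>1 > \<dots> > s\<^bsub>n-1\<^esub> > 0\<close> (the list \<open>ss\<close>) such that the clock of \<open>x\<^sub>i\<close> rings at time \<open>s\<^sub>i\<close>.\<close>

definition influences ::
    "'v set set \<Rightarrow> ('v \<Rightarrow> real set) \<Rightarrow> real \<Rightarrow> 'v \<Rightarrow> 'v \<Rightarrow> bool" where
  "influences E r t x y \<longleftrightarrow>
    (\<exists>xs ss. length xs = Suc (length ss) \<and> hd xs = x \<and> last xs = y \<and>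
      (\<forall>i<length ss. {xs ! i, xs ! Suc i} \<in> E \<and> ss ! i \<in> r (xs ! i)) \<and>
      sorted_wrt (>) ss \<and> set ss \<subseteq> {0<..t})"

text \<open>Since this is an almost sure statement about the clocks only, it depends on \<open>M\<close> and \<open>R\<close> only
  through the law of the clocks, that is, it is a property of the graph.\<close>

definition median_dynamics_well_defined ::
    "'v set \<Rightarrow> 'v set set \<Rightarrow> 'a measure \<Rightarrow> ('v \<Rightarrow> 'a \<Rightarrow> real set) \<Rightarrow> bool" where
  "median_dynamics_well_defined V E M R \<longleftrightarrow>
    (\<forall>x\<in>V. \<forall>t\<ge>0. AE \<omega> in M. finite {y. influences E (\<lambda>z. R z \<omega>) t x y})"

end

theory Submission
  imports Defs
begin

text \<open>
  Threshold maps commute with the median. A threshold map is antitone and takes two values, so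
  in the sorted list of an odd number of entries the entries with the same image as the middle one
  include one whole half of the list together with the middle one. They are a strict majority, that
  is, the image of the median is the most common of the images
  (\<open>most_common_image_eq_of_bool_median\<close>).

  Median dynamics and majority dynamics are driven by the same clocks, and a ring changes one value
  as a function of the left limits of the values nearby. Local finiteness of the clocks makes each
  coordinate constant just before a ring, so left limits commute with every map, the discontinuous
  threshold map included (\<open>Lim_at_left_image\<close>). Hence the threshold map carries each trajectory of
  median dynamics to a trajectory of majority dynamics (\<open>updates_at_rings_image\<close>), outside the null
  event that one of the countably many clocks is not locally finite. At time zero the thresholded
  values are a coordinatewise measurable image of the initial values. This preserves the
  independence of the vertices and the independence from the clocks
  (\<open>initial_independent_of_clocks_compose\<close>), and turns uniform variables into Bernoulli ones.
\<close>

section \<open>Median and majority\<close>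

lemma count_add_count_le_size:
  assumes "v \<noteq> w"
  shows "count A v + count A w \<le> size A"
  using assms by (induction A) auto

lemma most_common_eqI:
  assumes "size A < 2 * count A v"
  shows "most_common A = v"
  unfolding most_common_def
proof (rule the_equality)
  show less: "\<forall>w. w \<noteq> v \<longrightarrow> count A w < count A v"
  proof (intro allI impI)
    fix w assume "w \<noteq> v"
    from count_add_count_le_size[OF this, of A] assms show "count A w < count A v" by linarith
  qed
  fix u assume "\<forall>w. w \<noteq> u \<longrightarrow> count A w < count A u"
  with less show "u = v" by (metis less_asym)
qed

lemma count_image_mset_eq_card_nth:
  "count (image_mset f (mset xs)) v = card {i. i < length xs \<and> f (xs ! i) = v}"
proof -
  have "count (image_mset f (mset xs)) v = length (filter (\<lambda>x. f x = v) xs)"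
    by (induction xs) auto
  then show ?thesis by (simp add: length_filter_conv_card)
qed

text \<open>
  If the middle entry satisfies \<open>P\<close>, so do all entries before it; if it does not, neither does any
  entry after it. Either way more than half of the entries agree with it on \<open>P\<close>.
\<close>

lemma most_common_image_eq_of_bool_median:
  fixes A :: "'b::linorder multiset"
  assumes odd: "odd (size A)"
    and down: "\<And>x y. x \<in># A \<Longrightarrow> y \<in># A \<Longrightarrow> x \<le> y \<Longrightarrow> P y \<Longrightarrow> P x"
  shows "most_common (image_mset (\<lambda>x. of_bool (P x)) A) = (of_bool (P (median A)) :: 'c::zero_neq_one)"
proof (rule most_common_eqI)
  define xs where "xs = sorted_list_of_multiset A"
  define k where "k = size A div 2"
  have A: "A = mset xs" and sorted: "sorted xs" by (simp_all add: xs_def)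
  have len: "length xs = 2 * k + 1" using odd unfolding k_def A by simp
  have med: "median A = xs ! k" by (simp add: median_def xs_def k_def)
  define I where "I = {i. i < length xs \<and> of_bool (P (xs ! i)) = (of_bool (P (xs ! k)) :: 'c)}"
  have P_mono: "P (xs ! i)" if "i \<le> j" "j < length xs" "P (xs ! j)" for i j
    using that sorted by (intro down[of "xs ! i" "xs ! j"]) (auto simp: A sorted_nth_mono)
  have "k + 1 \<le> card I"
  proof (cases "P (xs ! k)")
    case True
    then have "{..k} \<subseteq> I" using P_mono[of _ k] by (auto simp: I_def len)
    from card_mono[OF _ this] show ?thesis by (simp add: I_def)
  next
    case False
    then have "{k..2 * k} \<subseteq> I" using P_mono[of k, unfolded len] by (fastforce simp: I_def len)
    from card_mono[OF _ this] show ?thesis by (simp add: I_def)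
  qed
  moreover have "count (image_mset (\<lambda>x. of_bool (P x)) A) (of_bool (P (median A)) :: 'c) = card I"
    unfolding med unfolding A count_image_mset_eq_card_nth I_def ..
  moreover have "size (image_mset (\<lambda>x. of_bool (P x) :: 'c) A) = 2 * k + 1"
    by (simp add: A len)
  ultimately show "size (image_mset (\<lambda>x. of_bool (P x) :: 'c) A)
      < 2 * count (image_mset (\<lambda>x. of_bool (P x)) A) (of_bool (P (median A)) :: 'c)"
    by linarith
qed

section \<open>Neighbourhoods\<close>

lemma neighbours_subset:
  assumes "simple_graph V E"
  shows "neighbours E x \<subseteq> V"
  using assms by (auto simp: simple_graph_def neighbours_def)

lemma not_self_neighbour:
  assumes "simple_graph V E"
  shows "x \<notin> neighbours E x"
  using assms by (fastforce simp: simple_graph_def neighbours_def)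

lemma odd_nbhd_subset:
  assumes "simple_graph V E" "x \<in> V"
  shows "odd_nbhd E x \<subseteq> V"
  using assms neighbours_subset[of V E x] by (auto simp: odd_nbhd_def)

lemma finite_odd_nbhd:
  assumes "locally_finite_graph V E" "x \<in> V"
  shows "finite (odd_nbhd E x)"
  using assms by (auto simp: odd_nbhd_def locally_finite_graph_def)

lemma odd_card_odd_nbhd:
  assumes "simple_graph V E" "locally_finite_graph V E" "x \<in> V"
  shows "odd (card (odd_nbhd E x))"
  using assms not_self_neighbour[of V E x]
  by (auto simp: odd_nbhd_def locally_finite_graph_def)

section \<open>Images of trajectories\<close>

text \<open>
  Before \<open>s\<close> there is a last point of \<open>r\<close>, or else the starting time \<open>0\<close>; from there on \<open>Y\<close> does
  not change until \<open>s\<close>.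
\<close>

lemma eventually_constant_at_left:
  fixes s :: real and Y :: "real \<Rightarrow> 'b"
  assumes "0 < s" and fin: "finite (r \<inter> {..s})"
    and const: "\<And>u t. 0 \<le> u \<Longrightarrow> u \<le> t \<Longrightarrow> r \<inter> {u<..t} = {} \<Longrightarrow> Y t = Y u"
  shows "\<exists>u\<ge>0. eventually (\<lambda>t. Y t = Y u) (at_left s)"
proof -
  define J where "J = insert 0 (r \<inter> {0..<s})"
  define m where "m = Max J"
  have "finite J" unfolding J_def
    by (rule finite.insertI, rule finite_subset[OF _ fin]) auto
  moreover have "J \<noteq> {}" by (simp add: J_def)
  ultimately have m: "m \<in> J" and le: "\<And>j. j \<in> J \<Longrightarrow> j \<le> m"
    unfolding m_def by (simp_all only: Max_in Max_ge not_False_eq_True)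
  from m \<open>0 < s\<close> have "0 \<le> m" "m < s" by (auto simp: J_def)
  have "Y t = Y m" if "m < t" "t < s" for t
  proof (rule const)
    show "r \<inter> {m<..t} = {}"
    proof (rule ccontr)
      assume "r \<inter> {m<..t} \<noteq> {}"
      then obtain j where "j \<in> r" "m < j" "j \<le> t" by auto
      with \<open>0 \<le> m\<close> that have "j \<in> J" by (auto simp: J_def)
      from le[OF this] \<open>m < j\<close> show False by simp
    qed
  qed (use \<open>0 \<le> m\<close> that in auto)
  with \<open>m < s\<close> have "eventually (\<lambda>t. Y t = Y m) (at_left s)"
    unfolding eventually_at_left_field by blast
  with \<open>0 \<le> m\<close> show ?thesis by blast
qed

lemma Lim_at_left_eventually_const:
  fixes s :: real and c :: "'b::t2_space"
  assumes "eventually (\<lambda>t. Y t = c) (at_left s)"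
  shows "Lim (at_left s) Y = c"
  by (rule tendsto_Lim[OF trivial_limit_at_left_real tendsto_eventually[OF assms]])

text \<open>The left limit is an attained value, so even a discontinuous \<open>f\<close> commutes with it.\<close>

lemma Lim_at_left_image:
  fixes s :: real and Y :: "real \<Rightarrow> 'b::t2_space" and f :: "'b \<Rightarrow> 'c::t2_space"
  assumes "0 < s" "finite (r \<inter> {..s})"
    and "\<And>u t. 0 \<le> u \<Longrightarrow> u \<le> t \<Longrightarrow> r \<inter> {u<..t} = {} \<Longrightarrow> Y t = Y u"
    and Y_in: "\<And>u. 0 \<le> u \<Longrightarrow> Y u \<in> S"
  shows "Lim (at_left s) (\<lambda>u. f (Y u)) = f (Lim (at_left s) Y)"
    and "Lim (at_left s) Y \<in> S"
proof -
  have "\<exists>u\<ge>0. eventually (\<lambda>t. Y t = Y u) (at_left s)"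
    by (rule eventually_constant_at_left[where r = r and Y = Y and s = s]) fact+
  then obtain u where u: "0 \<le> u" "eventually (\<lambda>t. Y t = Y u) (at_left s)" by blast
  from u(2) have "eventually (\<lambda>t. f (Y t) = f (Y u)) (at_left s)"
    by eventually_elim simp
  then have "Lim (at_left s) (\<lambda>u. f (Y u)) = f (Y u)"
    by (rule Lim_at_left_eventually_const)
  moreover have lim: "Lim (at_left s) Y = Y u"
    by (rule Lim_at_left_eventually_const) (rule u(2))
  ultimately show "Lim (at_left s) (\<lambda>u. f (Y u)) = f (Lim (at_left s) Y)" by (simp only:)
  show "Lim (at_left s) Y \<in> S" unfolding lim by (rule Y_in[OF u(1)])
qed

text \<open>
  At a ring the new value is computed from left limits, which \<open>f\<close> commutes with, by a rule \<open>F\<close> that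
  \<open>f\<close> turns into \<open>G\<close>. The convention on neighbourhoods enters through the parity: only multisets
  of odd size occur, and for these the median and the most common value are meant.
\<close>

lemma updates_at_rings_image:
  assumes graph: "simple_graph V E" "locally_finite_graph V E"
    and clocks: "\<And>x. x \<in> V \<Longrightarrow> r x \<subseteq> {0<..}" "\<And>x t. x \<in> V \<Longrightarrow> finite (r x \<inter> {..t})"
    and X_in: "\<And>t x. 0 \<le> t \<Longrightarrow> x \<in> V \<Longrightarrow> X t x \<in> S"
    and upd: "updates_at_rings F V E r X"
    and commute: "\<And>A. odd (size A) \<Longrightarrow> set_mset A \<subseteq> S \<Longrightarrow> G (image_mset f A) = f (F A)"
  shows "updates_at_rings G V E r (\<lambda>t x. f (X t x))"
  unfolding updates_at_rings_def
proof (intro ballI conjI allI impI)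
  fix x s assume x: "x \<in> V" and s: "s \<in> r x"
  with clocks have "0 < s" by auto
  define L where "L z = Lim (at_left s) (\<lambda>u. X u z)" for z
  define A where "A = image_mset L (mset_set (odd_nbhd E x))"
  have L: "Lim (at_left s) (\<lambda>u. f (X u z)) = f (L z)" "L z \<in> S" if "z \<in> odd_nbhd E x" for z
  proof -
    from that odd_nbhd_subset[OF graph(1) x] have z: "z \<in> V" by auto
    have const: "X t z = X u z" if "0 \<le> u" "u \<le> t" "r z \<inter> {u<..t} = {}" for u t
      using upd z that by (auto simp: updates_at_rings_def)
    note lim = Lim_at_left_image[where r = "r z" and Y = "\<lambda>u. X u z" and S = S,
        OF \<open>0 < s\<close> clocks(2)[OF z] const X_in[OF _ z]]
    show "Lim (at_left s) (\<lambda>u. f (X u z)) = f (L z)" unfolding L_def by (rule lim(1))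
    show "L z \<in> S" unfolding L_def by (rule lim(2))
  qed
  note fin = finite_odd_nbhd[OF graph(2) x]
  have "image_mset (\<lambda>z. Lim (at_left s) (\<lambda>u. f (X u z))) (mset_set (odd_nbhd E x))
      = image_mset f A"
    unfolding A_def multiset.map_comp comp_def
    by (rule image_mset_cong) (simp add: L(1) elem_mset_set[OF fin])
  moreover have "odd (size A)"
    using odd_card_odd_nbhd[OF graph x] by (simp add: A_def)
  moreover have "set_mset A \<subseteq> S" using fin L(2) by (auto simp: A_def)
  moreover have "X s x = F A"
    using upd x s unfolding updates_at_rings_def A_def L_def[abs_def] by blast
  ultimately show "f (X s x)
      = G (image_mset (\<lambda>z. Lim (at_left s) (\<lambda>u. f (X u z))) (mset_set (odd_nbhd E x)))"
    by (metis commute)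
next
  fix x s t assume "x \<in> V" "0 \<le> s \<and> s \<le> t \<and> r x \<inter> {s<..t} = {}"
  with upd have "X t x = X s x" unfolding updates_at_rings_def by blast
  then show "f (X t x) = f (X s x)" by simp
qed

section \<open>Images of the initial values\<close>

text \<open>
  Applying \<open>f\<close> at every vertex is measurable for the product \<open>\<sigma>\<close>-algebra, so the new initial
  configuration generates a smaller \<open>\<sigma>\<close>-algebra, which inherits the independence.
\<close>

lemma initial_independent_of_clocks_compose:
  assumes "prob_space M"
    and meas: "\<And>x. x \<in> V \<Longrightarrow> X x \<in> borel_measurable M"
    and f [measurable]: "f \<in> borel_measurable borel"
    and indep: "initial_independent_of_clocks V M X R"
  shows "initial_independent_of_clocks V M (\<lambda>x \<omega>. f (X x \<omega>)) R"
proof -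
  interpret prob_space M by fact
  let ?N = "PiM V (\<lambda>_. borel) :: ('b \<Rightarrow> real) measure"
  let ?X = "\<lambda>\<omega>. \<lambda>x\<in>V. X x \<omega>"
  let ?g = "\<lambda>c. \<lambda>x\<in>V. f (c x)"
  have g: "?g \<in> measurable ?N ?N" by measurable
  have X: "?X \<in> space M \<rightarrow> space ?N" by (auto simp: space_PiM)
  have comp: "(\<lambda>\<omega>. \<lambda>x\<in>V. f (X x \<omega>)) = (\<lambda>\<omega>. ?g (?X \<omega>))" by (auto simp: fun_eq_iff)
  have meas_g: "(\<lambda>\<omega>. ?g (?X \<omega>)) \<in> measurable (vimage_algebra (space M) ?X ?N) ?N"
    by (rule measurable_compose[OF measurable_vimage_algebra1[OF X] g])
  have pre: "(\<lambda>\<omega>. ?g (?X \<omega>)) -` A \<inter> space M \<in> sets (vimage_algebra (space M) ?X ?N)"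
    if "A \<in> sets ?N" for A
    using measurable_sets[OF meas_g that] by (simp only: space_vimage_algebra)
  have into: "(\<lambda>\<omega>. ?g (?X \<omega>)) \<in> space M \<rightarrow> space ?N" by (auto simp: space_PiM)
  have sub: "sets (vimage_algebra (space M) (\<lambda>\<omega>. \<lambda>x\<in>V. f (X x \<omega>)) ?N)
      \<subseteq> sets (vimage_algebra (space M) ?X ?N)"
    unfolding comp sets_vimage_algebra2[OF into]
  proof (rule subsetI, elim CollectE exE conjE)
    fix B A assume "B = (\<lambda>\<omega>. ?g (?X \<omega>)) -` A \<inter> space M" "A \<in> sets ?N"
    then show "B \<in> sets (vimage_algebra (space M) ?X ?N)" by (simp only: pre)
  qed
  from indep show ?thesis
    unfolding initial_independent_of_clocks_def indep_set_def
    by (rule indep_sets_mono_sets) (use sub in \<open>auto split: bool.splits\<close>)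
qed

lemma iid_compose:
  assumes "prob_space M" and f: "f \<in> borel_measurable borel" and "iid V M X \<mu>"
  shows "iid V M (\<lambda>x \<omega>. f (X x \<omega>)) (distr \<mu> borel f)"
proof -
  interpret prob_space M by fact
  from assms have indep: "indep_vars (\<lambda>_. borel) X V"
    and law: "\<And>x. x \<in> V \<Longrightarrow> distr M borel (X x) = \<mu>" by (auto simp: iid_def)
  have "distr M borel (\<lambda>\<omega>. f (X x \<omega>)) = distr \<mu> borel f" if "x \<in> V" for x
  proof -
    from indep that have "X x \<in> borel_measurable M" by (auto simp: indep_vars_def)
    from distr_distr[OF f this] law[OF that] show ?thesis by (simp add: comp_def)
  qed
  with indep_vars_compose2[OF indep] f show ?thesis by (auto simp: iid_def)
qed

text \<open>
  The comparison is made on the two-point space of truth values, where a law is determined by the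
  mass of each point, and is then transported to the reals.
\<close>

lemma uniform_threshold_bernoulli:
  fixes p :: real
  assumes "0 \<le> p" "p \<le> 1"
  shows "distr (uniform_measure lborel {0..1}) borel (\<lambda>u. of_bool (u \<in> {0..p}))
    = (distr (measure_pmf (bernoulli_pmf p)) borel of_bool :: real measure)"
proof -
  let ?U = "uniform_measure lborel {0..1::real}"
  let ?B = "distr ?U (count_space UNIV) (\<lambda>u. u \<in> {0..p})"
  interpret U: prob_space ?U by (rule prob_space_uniform_measure) simp_all
  have sets_U: "sets ?U = sets borel" by simp
  have "(\<lambda>u. u \<in> {0..p}) \<in> measurable borel (count_space UNIV)" by measurable
  then have meas: "(\<lambda>u. u \<in> {0..p}) \<in> measurable ?U (count_space UNIV)"
    by (subst measurable_cong_sets[OF sets_U refl])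
  have True_mass: "measure ?B {True} = p"
  proof -
    have preimage: "(\<lambda>u. u \<in> {0..p}) -` {True} \<inter> space ?U = {0..p}"
      by (simp only: space_uniform_measure space_lborel space_borel vimage_def Int_UNIV_right singleton_iff
          eq_True Collect_mem_eq)
    have inter: "{0..1} \<inter> {0..p} = {0..p}" using assms by auto
    have "measure ?B {True} = measure ?U {0..p}"
      by (subst measure_distr[OF meas]) (simp_all only: preimage sets_count_space Pow_UNIV UNIV_I)
    also have "\<dots> = measure lborel ({0..1} \<inter> {0..p}) / measure lborel {0..1::real}"
      by (rule measure_uniform_measure) simp_all
    also have "\<dots> = p" unfolding inter using assms by simp
    finally show ?thesis .
  qed
  interpret B: prob_space ?B by (rule U.prob_space_distr[OF meas])
  have "measure ?B {False} = 1 - p"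
    using B.prob_compl[of "{True}"] True_mass by (simp add: UNIV_bool insert_Diff_if)
  with True_mass assms have mass: "measure ?B {b} = pmf (bernoulli_pmf p) b" for b
    by (cases b) simp_all
  have "?B = measure_pmf (bernoulli_pmf p)"
  proof (rule measure_eqI_finite[where A = UNIV])
    show "emeasure ?B {b} = emeasure (measure_pmf (bernoulli_pmf p)) {b}" for b
      by (simp only: B.emeasure_eq_measure mass emeasure_pmf_single)
  qed simp_all
  then have "distr (measure_pmf (bernoulli_pmf p)) borel of_bool
      = (distr ?B borel of_bool :: real measure)" by simp
  also have "\<dots> = distr ?U borel (\<lambda>u. of_bool (u \<in> {0..p}))"
    by (subst distr_distr[OF _ meas]) (simp_all add: comp_def)
  finally show ?thesis ..
qed

section \<open>Median dynamics and majority dynamics\<close>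

theorem proposition2p2:
  fixes V :: "'v set" and E :: "'v set set"
    and M :: "'a measure" and R :: "'v \<Rightarrow> 'a \<Rightarrow> real set"
    and \<eta> :: "real \<Rightarrow> 'v \<Rightarrow> 'a \<Rightarrow> real" and p :: real
  assumes "simple_graph V E" and "countable V" and "locally_finite_graph V E"
    and "median_dynamics_well_defined V E M R"
    and "median_dynamics V E M R \<eta>"
    and "0 \<le> p" and "p \<le> 1"
  defines "\<xi> \<equiv> \<lambda>t x \<omega>. indicator {0..p} (\<eta> t x \<omega>) :: real"
  shows "majority_dynamics V E M R \<xi> \<and>
    iid V M (\<xi> 0) (distr (measure_pmf (bernoulli_pmf p)) borel of_bool)"
proof -
  define f :: "real \<Rightarrow> real" where "f = (\<lambda>u. of_bool (u \<in> {0..p}))"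
  have \<xi>: "\<xi> = (\<lambda>t x \<omega>. f (\<eta> t x \<omega>))" by (simp add: \<xi>_def f_def indicator_def)
  have f [measurable]: "f \<in> borel_measurable borel" unfolding f_def by measurable
  from \<open>median_dynamics V E M R \<eta>\<close> have M: "prob_space M"
    and meas: "\<And>t x. 0 \<le> t \<Longrightarrow> x \<in> V \<Longrightarrow> \<eta> t x \<in> borel_measurable M"
    and range: "\<And>t x \<omega>. 0 \<le> t \<Longrightarrow> x \<in> V \<Longrightarrow> \<omega> \<in> space M \<Longrightarrow> \<eta> t x \<omega> \<in> {0..1}"
    and clocks: "independent_poisson_clocks V M R"
    and init: "initial_independent_of_clocks V M (\<eta> 0) R"
    and upd: "AE \<omega> in M. updates_at_rings median V E (\<lambda>x. R x \<omega>) (\<lambda>t x. \<eta> t x \<omega>)"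
    and iid: "iid V M (\<eta> 0) (uniform_measure lborel {0..1})"
    by (auto simp: median_dynamics_def local_dynamics_def)
  have commute: "most_common (image_mset f A) = f (median A)"
    if "odd (size A)" "set_mset A \<subseteq> {0..1}" for A
    unfolding f_def using that by (intro most_common_image_eq_of_bool_median) auto
  have "AE \<omega> in M. \<forall>x\<in>V. R x \<omega> \<subseteq> {0<..} \<and> (\<forall>t. finite (R x \<omega> \<inter> {..t}))"
    using clocks \<open>countable V\<close>
    by (auto simp: AE_ball_countable independent_poisson_clocks_def rate_one_poisson_clock_def)
  with upd AE_space
  have "AE \<omega> in M. updates_at_rings most_common V E (\<lambda>x. R x \<omega>) (\<lambda>t x. f (\<eta> t x \<omega>))"
  proof eventually_elim
    case (elim \<omega>)
    show ?case
      by (rule updates_at_rings_image[OF assms(1,3), where S = "{0..1}" and F = median])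
        (use elim range commute in auto)
  qed
  moreover have "initial_independent_of_clocks V M (\<lambda>x \<omega>. f (\<eta> 0 x \<omega>)) R"
    by (rule initial_independent_of_clocks_compose[OF M _ f init]) (simp add: meas)
  moreover have "(\<lambda>\<omega>. f (\<eta> t x \<omega>)) \<in> borel_measurable M" if "0 \<le> t" "x \<in> V" for t x
    by (rule measurable_compose[OF meas[OF that] f])
  ultimately have "majority_dynamics V E M R \<xi>"
    using M clocks unfolding majority_dynamics_def local_dynamics_def \<xi> by (auto simp: f_def)
  moreover have "iid V M (\<xi> 0) (distr (measure_pmf (bernoulli_pmf p)) borel of_bool)"
    using iid_compose[OF M f iid] uniform_threshold_bernoulli[OF \<open>0 \<le> p\<close> \<open>p \<le> 1\<close>]
    by (simp add: \<xi> f_def)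
  ultimately show ?thesis ..
qed

end
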